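(* Let $(X,d)$ be a compact metric space, let $f:X\to X$ be a continuous surjection, and let $\mathbb{F}=(f_n)_{n\in\mathbb{N}}$ be a sequence of feeble open continuous surjections $f_n:X\to X$ such that $f_n\circ f=f\circ f_n$ for every $n\in\mathbb{N}$. If $\sum_{n=1}^{\infty} D(f_n,f)<\infty$, then $(X,f)$ is sensitive if and only if $(X,\mathbb{F})$ is sensitive.
   Context: $D(g,h)=\sup_{x\in X}d(g(x),h(x))$ for continuous self maps $g,h$ of $X$. A map $g:X\to X$ is feeble open if $\mathrm{int}(g(U))\neq\emptyset$ for every non-empty open $U\subset X$. For $\mathbb{F}=(f_n)_{n\in\mathbb{N}}$ (with $\mathbb{N}=\{1,2,\dots\}$), put $\omega_n=f_n\circ f_{n-1}\circ\cdots\circ f_1$; $(X,\mathbb{F})$ denotes the non-autonomous system with orbits $\{\omega_n(x):n\in\mathbb{N}\}$. $(X,\mathbb{F})$ is sensitive if there is $\delta>0$ such that for each $x\in X$ and each neighborhood $U$ of $x$ there is $n\in\mathbb{N}$ with $\mathrm{diam}(\omega_n(U))>\delta$. $(X,f)$ is sensitive if the same holds with $\omega_n$ replaced by $f^n$. *)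

theory Defs
  imports "HOL-Analysis.Analysis"
begin

definition sup_dist :: "('a::metric_space \<Rightarrow> 'a) \<Rightarrow> ('a \<Rightarrow> 'a) \<Rightarrow> real" where
  "sup_dist g h = (SUP x. dist (g x) (h x))"

definition feeble_open :: "('a::topological_space \<Rightarrow> 'a) \<Rightarrow> bool" where
  "feeble_open g \<longleftrightarrow> (\<forall>U. open U \<and> U \<noteq> {} \<longrightarrow> interior (g ` U) \<noteq> {})"

text \<open>Sequences of maps are indexed from 1: the value at index 0 is never used, and
  index 0 of the compositions is the identity.\<close>

primrec nonaut_iter :: "(nat \<Rightarrow> 'a \<Rightarrow> 'a) \<Rightarrow> nat \<Rightarrow> 'a \<Rightarrow> 'a" where
  "nonaut_iter F 0 = id"
| "nonaut_iter F (Suc n) = F (Suc n) \<circ> nonaut_iter F n"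

text \<open>Sensitivity with respect to a family \<open>w\<close> of time-\<open>n\<close> maps, \<open>n \<ge> 1\<close>. A neighbourhood
  of \<open>x\<close> is any set having \<open>x\<close> in its interior.\<close>

definition sensitive_family :: "(nat \<Rightarrow> 'a::metric_space \<Rightarrow> 'a) \<Rightarrow> bool" where
  "sensitive_family w \<longleftrightarrow>
    (\<exists>\<delta>>0. \<forall>x U. x \<in> interior U \<longrightarrow> (\<exists>n\<ge>1. diameter (w n ` U) > \<delta>))"

definition sensitive :: "('a::metric_space \<Rightarrow> 'a) \<Rightarrow> bool" where
  "sensitive f \<longleftrightarrow> sensitive_family (\<lambda>n. f ^^ n)"

definition nonaut_sensitive :: "(nat \<Rightarrow> 'a::metric_space \<Rightarrow> 'a) \<Rightarrow> bool" where
  "nonaut_sensitive F \<longleftrightarrow> sensitive_family (nonaut_iter F)"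

end

theory Submission
  imports Defs
begin

text \<open>Since each $f_n$ commutes with $f$, replacing the factors of $f_{k+n} \circ \dots \circ f_{k+1}$
  by $f$ one after the other moves every point by at most $D(f_{k+i}, f)$ at the $i$-th step: no
  error is amplified. So $\omega_{k+n}$ stays within $\varepsilon_k = \sum_{i>k} D(f_i, f)$ of
  $f^n \circ \omega_k$, uniformly in $n$, and $\varepsilon_k \to 0$. Sensitivity of $f$ passes to
  the sequence because $\omega_k(U)$ has interior points; conversely, one pulls $U$ back by the
  continuous surjection $\omega_k$ to an open set, and shrinks this set until it can only be spread
  at times beyond $k$.\<close>

text \<open>Boundedness makes the supremum inside \<open>diameter\<close> a genuine one, so
  exceeding a positive \<delta> is witnessed by a pair of points, with the same \<delta>. Passing
  from a neighbourhood to its interior only shrinks the choice of witnesses, so open sets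
  suffice.\<close>

lemma sensitive_family_iff_dist:
  fixes w :: "nat \<Rightarrow> 'a::metric_space \<Rightarrow> 'a"
  assumes "bounded (UNIV :: 'a set)"
  shows "sensitive_family w \<longleftrightarrow>
    (\<exists>\<delta>>0. \<forall>U. open U \<and> U \<noteq> {} \<longrightarrow>
      (\<exists>n\<ge>1. \<exists>x\<in>U. \<exists>y\<in>U. dist (w n x) (w n y) > \<delta>))"
proof -
  have bdd: "bounded S" for S :: "'a set"
    using assms by (rule bounded_subset) simp
  have diam: "diameter (w n ` U) > \<delta> \<longleftrightarrow> (\<exists>x\<in>U. \<exists>y\<in>U. dist (w n x) (w n y) > \<delta>)"
    if "\<delta> > 0" for \<delta> n U
    using diameter_lower_bounded[OF bdd that, of "w n ` U"]
      diameter_bounded_bound[OF bdd, of _ "w n ` U"]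
    by (auto intro: less_le_trans)
  have "(\<forall>x U. x \<in> interior U \<longrightarrow> (\<exists>n\<ge>1. \<exists>x\<in>U. \<exists>y\<in>U. dist (w n x) (w n y) > \<delta>)) \<longleftrightarrow>
    (\<forall>U. open U \<and> U \<noteq> {} \<longrightarrow> (\<exists>n\<ge>1. \<exists>x\<in>U. \<exists>y\<in>U. dist (w n x) (w n y) > \<delta>))"
    (is "?L \<longleftrightarrow> ?R") for \<delta>
  proof
    show ?R if ?L
    proof (intro allI impI)
      fix U :: "'a set" assume "open U \<and> U \<noteq> {}"
      then obtain x where "x \<in> interior U"
        by (auto simp: interior_open)
      then show "\<exists>n\<ge>1. \<exists>x\<in>U. \<exists>y\<in>U. dist (w n x) (w n y) > \<delta>"
        using that by blast
    qed
    show ?L if R: ?R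
    proof (intro allI impI)
      fix x and U :: "'a set" assume "x \<in> interior U"
      then obtain n a b where "n \<ge> 1" "a \<in> interior U" "b \<in> interior U" "dist (w n a) (w n b) > \<delta>"
        using R[rule_format, of "interior U"] by auto
      then show "\<exists>n\<ge>1. \<exists>x\<in>U. \<exists>y\<in>U. dist (w n x) (w n y) > \<delta>"
        using interior_subset by blast
    qed
  qed
  then show ?thesis
    unfolding sensitive_family_def by (intro ex_cong1 conj_cong refl) (simp only: diam)
qed

lemma dist_le_sup_dist:
  fixes g h :: "'a::metric_space \<Rightarrow> 'a"
  assumes "bounded (UNIV :: 'a set)"
  shows "dist (g x) (h x) \<le> sup_dist g h"
  unfolding sup_dist_def
proof (rule cSUP_upper)
  show "bdd_above (range (\<lambda>x. dist (g x) (h x)))"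
    using diameter_bounded_bound[OF assms] by (intro bdd_aboveI) auto
qed simp

lemma sup_dist_nonneg:
  fixes g h :: "'a::metric_space \<Rightarrow> 'a"
  assumes "bounded (UNIV :: 'a set)"
  shows "0 \<le> sup_dist g h"
  using dist_le_sup_dist[OF assms] zero_le_dist order_trans by blast

lemma feeble_open_comp:
  fixes g h :: "'a::topological_space \<Rightarrow> 'a"
  assumes "feeble_open g" "feeble_open h"
  shows "feeble_open (h \<circ> g)"
  unfolding feeble_open_def
proof (intro allI impI)
  fix U :: "'a set" assume "open U \<and> U \<noteq> {}"
  then have "interior (h ` interior (g ` U)) \<noteq> {}"
    using assms unfolding feeble_open_def by simp
  moreover have "interior (h ` interior (g ` U)) \<subseteq> interior ((h \<circ> g) ` U)"
    unfolding image_comp[symmetric] by (intro interior_mono image_mono interior_subset)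
  ultimately show "interior ((h \<circ> g) ` U) \<noteq> {}"
    by blast
qed

lemma feeble_open_nonaut_iter:
  assumes "\<And>n. n \<ge> 1 \<Longrightarrow> feeble_open (F n)"
  shows "feeble_open (nonaut_iter F n)"
proof (induction n)
  case 0
  show ?case
    by (simp add: feeble_open_def interior_open)
next
  case (Suc n)
  then show ?case
    unfolding nonaut_iter.simps by (intro feeble_open_comp assms) simp_all
qed

lemma surj_nonaut_iter:
  assumes "\<And>n. n \<ge> 1 \<Longrightarrow> surj (F n)"
  shows "surj (nonaut_iter F n)"
proof (induction n)
  case (Suc n)
  then show ?case
    unfolding nonaut_iter.simps by (intro comp_surj assms) simp_all
qed simp

lemma continuous_on_nonaut_iter:
  fixes F :: "nat \<Rightarrow> 'a::topological_space \<Rightarrow> 'a"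
  assumes "\<And>n. n \<ge> 1 \<Longrightarrow> continuous_on UNIV (F n)"
  shows "continuous_on UNIV (nonaut_iter F n)"
proof (induction n)
  case (Suc n)
  then show ?case
    using assms[of "Suc n"] unfolding nonaut_iter.simps
    by (intro continuous_on_compose) (auto intro: continuous_on_subset)
qed (simp add: id_def)

lemma funpow_commute:
  assumes "g \<circ> f = f \<circ> g"
  shows "(f ^^ n) (g x) = g ((f ^^ n) x)"
proof (induction n)
  case (Suc n)
  then show ?case
    using fun_cong[OF assms, of "(f ^^ n) x"] by simp
qed simp

text \<open>Peeling off the innermost factor makes the error term $d(f_{k+1} z, f z)$ with
  $z = f^n(\omega_k x)$; peeling off the outermost one would leave an error to be transported by
  $f$, which is not controlled.\<close>

lemma dist_nonaut_iter_funpow_le: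
  fixes f :: "'a::metric_space \<Rightarrow> 'a"
  assumes "bounded (UNIV :: 'a set)"
    and "\<And>n. n \<ge> 1 \<Longrightarrow> F n \<circ> f = f \<circ> F n"
  shows "dist (nonaut_iter F (k + n) x) ((f ^^ n) (nonaut_iter F k x))
    \<le> (\<Sum>i<n. sup_dist (F (Suc (i + k))) f)"
proof (induction n arbitrary: k)
  case (Suc n)
  define y where "y = nonaut_iter F k x"
  \<comment> \<open>Commutation moves \<open>F (Suc k)\<close> outside \<open>f ^^ n\<close>, so
    that \<open>F (Suc k)\<close> and \<open>f\<close> are compared at one and the same point
    \<open>(f ^^ n) y\<close>.\<close>
  have "(f ^^ n) (nonaut_iter F (Suc k) x) = F (Suc k) ((f ^^ n) y)"
    using funpow_commute[of "F (Suc k)" f] assms(2) by (simp add: y_def)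
  then have "dist ((f ^^ n) (nonaut_iter F (Suc k) x)) ((f ^^ Suc n) y) \<le> sup_dist (F (Suc k)) f"
    using dist_le_sup_dist[OF assms(1)] by simp
  \<comment> \<open>The peeled factor is absorbed into the starting map, so the induction hypothesis
    is needed at \<open>Suc k\<close>. Its sum is shifted by one index; the missing term i = 0 is
    the bound just obtained.\<close>
  moreover have "dist (nonaut_iter F (k + Suc n) x) ((f ^^ n) (nonaut_iter F (Suc k) x))
      \<le> (\<Sum>i<n. sup_dist (F (Suc (Suc i + k))) f)"
    using Suc.IH[of "Suc k"] by simp
  ultimately show ?case
    unfolding y_def sum.lessThan_Suc_shift
    using dist_triangle[of "nonaut_iter F (k + Suc n) x" "(f ^^ Suc n) (nonaut_iter F k x)"
        "(f ^^ n) (nonaut_iter F (Suc k) x)"] by simp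
qed simp

text \<open>The terms are nonnegative, so every finite error sum starting at k lies below the full
  tail of the series, which is small for a suitable k. The point is the order of choices: one k
  serves all n and x.\<close>

lemma nonaut_iter_uniformly_near_funpow:
  fixes f :: "'a::metric_space \<Rightarrow> 'a"
  assumes bdd: "bounded (UNIV :: 'a set)"
    and "\<And>n. n \<ge> 1 \<Longrightarrow> F n \<circ> f = f \<circ> F n"
    and sm: "summable (\<lambda>n. sup_dist (F (Suc n)) f)"
    and "e > 0"
  obtains k where "\<And>n x. dist (nonaut_iter F (k + n) x) ((f ^^ n) (nonaut_iter F k x)) < e"
proof -
  obtain k where k: "norm (\<Sum>i. sup_dist (F (Suc (i + k))) f) < e"
    using suminf_exist_split[OF \<open>e > 0\<close> sm] by blast
  have "dist (nonaut_iter F (k + n) x) ((f ^^ n) (nonaut_iter F k x)) < e" for n x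
  proof -
    have "(\<Sum>i<n. sup_dist (F (Suc (i + k))) f) \<le> (\<Sum>i. sup_dist (F (Suc (i + k))) f)"
      using sm summable_iff_shift[of "\<lambda>n. sup_dist (F (Suc n)) f" k]
      by (intro sum_le_suminf) (auto simp: sup_dist_nonneg[OF bdd])
    then show ?thesis
      using dist_nonaut_iter_funpow_le[of F f k n x, OF assms(1,2)] k by simp
  qed
  then show thesis
    by (rule that)
qed

lemma abs_dist_diff_less_of_near:
  assumes "dist a a' < e" "dist b b' < e"
  shows "\<bar>dist a b - dist a' b'\<bar> < 2 * e"
  using assms dist_triangle[of a b a'] dist_triangle[of a' b b'] dist_triangle[of a' b' a]
    dist_triangle[of a b' b] dist_commute[of a a'] dist_commute[of b b'] by linarith

text \<open>Only finitely many maps are involved, so the preimages of balls of radius \<delta>/2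
  around the points \<open>g n p\<close> intersect in an open set. This serves to rule out
  separation up to time k.\<close>

lemma small_open_nbhd_finitely_many:
  fixes g :: "nat \<Rightarrow> 'a::metric_space \<Rightarrow> 'b::metric_space"
  assumes "\<And>n. continuous_on UNIV (g n)" "open W" "p \<in> W" "\<delta> > 0"
  obtains V where "open V" "p \<in> V" "V \<subseteq> W"
    "\<And>n x y. \<lbrakk>n \<le> k; x \<in> V; y \<in> V\<rbrakk> \<Longrightarrow> dist (g n x) (g n y) < \<delta>"
proof
  define V where "V = W \<inter> (\<Inter>n\<le>k. g n -` ball (g n p) (\<delta> / 2))"
  have "open (g n -` ball (g n p) (\<delta> / 2))" for n
    using open_vimage[OF open_ball assms(1)] .
  then show "open V"
    unfolding V_def using \<open>open W\<close> by (intro open_Int open_INT) auto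
  show "p \<in> V" "V \<subseteq> W"
    using assms by (auto simp: V_def)
  show "dist (g n x) (g n y) < \<delta>" if "n \<le> k" "x \<in> V" "y \<in> V" for n x y
    by (rule dist_triangle_half_r[of "g n p"]) (use that in \<open>auto simp: V_def\<close>)
qed

theorem proposition8:
  fixes f :: "'a::metric_space \<Rightarrow> 'a"
    and F :: "nat \<Rightarrow> 'a \<Rightarrow> 'a"
  assumes "compact (UNIV :: 'a set)"
    and "continuous_on UNIV f" and "surj f"
    and "\<And>n. n \<ge> 1 \<Longrightarrow> continuous_on UNIV (F n)"
    and "\<And>n. n \<ge> 1 \<Longrightarrow> surj (F n)"
    and "\<And>n. n \<ge> 1 \<Longrightarrow> feeble_open (F n)"
    and "\<And>n. n \<ge> 1 \<Longrightarrow> F n \<circ> f = f \<circ> F n"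
    and "summable (\<lambda>n. sup_dist (F (Suc n)) f)"
  shows "sensitive f \<longleftrightarrow> nonaut_sensitive F"
proof -
  have bdd: "bounded (UNIV :: 'a set)"
    using assms(1) by (rule compact_imp_bounded)
  note near = nonaut_iter_uniformly_near_funpow[of F f, OF bdd assms(7,8)]
  show ?thesis
    unfolding sensitive_def nonaut_sensitive_def sensitive_family_iff_dist[OF bdd]
  proof (intro iffI; elim exE conjE)
    fix \<delta> :: real
    assume "\<delta> > 0" and sens: "\<forall>U. open U \<and> U \<noteq> {} \<longrightarrow>
      (\<exists>n\<ge>1. \<exists>x\<in>U. \<exists>y\<in>U. dist ((f ^^ n) x) ((f ^^ n) y) > \<delta>)"
    \<comment> \<open>Each of two points is displaced by less than \<delta>/4, so their distance
      changes by less than \<delta>/2, and a separation above \<delta> stays above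
      \<delta>/2.\<close>
    obtain k where k: "dist (nonaut_iter F (k + n) x) ((f ^^ n) (nonaut_iter F k x)) < \<delta> / 4"
      for n x using near[of "\<delta> / 4"] \<open>\<delta> > 0\<close> by auto
    have "\<exists>n\<ge>1. \<exists>x\<in>U. \<exists>y\<in>U. dist (nonaut_iter F n x) (nonaut_iter F n y) > \<delta> / 2"
      if "open U" "U \<noteq> {}" for U
    proof -
      \<comment> \<open>The image of U need not be open, but sensitivity of \<open>f\<close> can be
        applied to its interior; the separated points found there lift back to U.\<close>
      have "interior (nonaut_iter F k ` U) \<noteq> {}"
        using feeble_open_nonaut_iter[of F k, OF assms(6)] that by (simp add: feeble_open_def)
      then obtain n a b where "n \<ge> 1" and
        ab: "a \<in> interior (nonaut_iter F k ` U)" "b \<in> interior (nonaut_iter F k ` U)"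
        and far: "dist ((f ^^ n) a) ((f ^^ n) b) > \<delta>"
        using sens[rule_format, of "interior (nonaut_iter F k ` U)"] by auto
      obtain x y where xy: "x \<in> U" "y \<in> U" "a = nonaut_iter F k x" "b = nonaut_iter F k y"
        using ab[THEN subsetD[OF interior_subset]] by (elim imageE)
      have "dist (nonaut_iter F (k + n) x) (nonaut_iter F (k + n) y) > \<delta> / 2"
        using far abs_dist_diff_less_of_near[OF k[of n x] k[of n y]]
        unfolding xy(3,4) by linarith
      then show ?thesis
        using \<open>n \<ge> 1\<close> xy(1,2) by (intro exI[of _ "k + n"]) auto
    qed
    then show "\<exists>\<delta>>0. \<forall>U. open U \<and> U \<noteq> {} \<longrightarrow>
        (\<exists>n\<ge>1. \<exists>x\<in>U. \<exists>y\<in>U. dist (nonaut_iter F n x) (nonaut_iter F n y) > \<delta>)"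
      using \<open>\<delta> > 0\<close> by (intro exI[of _ "\<delta> / 2"]) auto
  next
    fix \<delta> :: real
    assume "\<delta> > 0" and sens: "\<forall>U. open U \<and> U \<noteq> {} \<longrightarrow>
      (\<exists>n\<ge>1. \<exists>x\<in>U. \<exists>y\<in>U. dist (nonaut_iter F n x) (nonaut_iter F n y) > \<delta>)"
    obtain k where k: "dist (nonaut_iter F (k + n) x) ((f ^^ n) (nonaut_iter F k x)) < \<delta> / 4"
      for n x using near[of "\<delta> / 4"] \<open>\<delta> > 0\<close> by auto
    note cont = continuous_on_nonaut_iter[of F, OF assms(4)]
    have "\<exists>n\<ge>1. \<exists>x\<in>U. \<exists>y\<in>U. dist ((f ^^ n) x) ((f ^^ n) y) > \<delta> / 2"
      if "open U" "U \<noteq> {}" for U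
    proof -
      \<comment> \<open>Surjectivity makes the open preimage of U nonempty, which leaves room for a
        smaller V around p.\<close>
      obtain p where "nonaut_iter F k p \<in> U"
        using surj_nonaut_iter[of F k, OF assms(5)] \<open>U \<noteq> {}\<close> by (metis ex_in_conv surjD)
      moreover have "open (nonaut_iter F k -` U)"
        using open_vimage[OF \<open>open U\<close> cont] .
      ultimately obtain V where V: "open V" "p \<in> V" "V \<subseteq> nonaut_iter F k -` U"
        and early: "\<And>n x y. \<lbrakk>n \<le> k; x \<in> V; y \<in> V\<rbrakk>
          \<Longrightarrow> dist (nonaut_iter F n x) (nonaut_iter F n y) < \<delta>"
        using small_open_nbhd_finitely_many[of "nonaut_iter F" "nonaut_iter F k -` U" p \<delta> k,
            OF cont] \<open>\<delta> > 0\<close> by auto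
      obtain n x y where xy: "x \<in> V" "y \<in> V"
        and far: "dist (nonaut_iter F n x) (nonaut_iter F n y) > \<delta>"
        using sens[rule_format, of V] V by auto
      have "n > k"
        using early[OF _ xy, of n] far by linarith
      \<comment> \<open>The strict inequality matters: times for \<open>f\<close> start at 1. The
        witnesses in U are the images of x and y under \<open>nonaut_iter F k\<close>.\<close>
      then obtain m where n: "n = k + m" and "m \<ge> 1"
        by (metis less_imp_add_positive Suc_leI One_nat_def)
      have "dist ((f ^^ m) (nonaut_iter F k x)) ((f ^^ m) (nonaut_iter F k y)) > \<delta> / 2"
        using far abs_dist_diff_less_of_near[OF k[of m x] k[of m y]] unfolding n by linarith
      then show ?thesis
        using \<open>m \<ge> 1\<close> subsetD[OF V(3)] xy by (auto simp: vimage_def)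
    qed
    then show "\<exists>\<delta>>0. \<forall>U. open U \<and> U \<noteq> {} \<longrightarrow>
        (\<exists>n\<ge>1. \<exists>x\<in>U. \<exists>y\<in>U. dist ((f ^^ n) x) ((f ^^ n) y) > \<delta>)"
      using \<open>\<delta> > 0\<close> by (intro exI[of _ "\<delta> / 2"]) auto
  qed
qed

end
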